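(* Let $(m(t),\,t\in\mathbb{R}_+)$ be a solution of Problem 1. As $t\to\infty$, $m(t)$ converges, for the weak topology on $\mathcal{P}[0,1]$, to some $m(\infty)$ which is a partial consensus for every $\Delta'<\Delta$, i.e., of the form $m(\infty)=\sum_{m=1}^{c}\alpha_m\delta_{x_m}$ with $x_m\in[0,1]$, $|x_m-x_{m'}|\ge\Delta$ for $m\ne m'$, and $\alpha_m>0$.
   Context: Fix $\Delta\in(0,1]$ and $w\in(0,1)$. $\mathcal{P}[0,1]$ is the set of Borel probability measures on $[0,1]$; $\langle h,\mu\rangle=\int h\,d\mu$. Problem 1: a family $(m(t),\,t\in\mathbb{R}_+)$ with $m(t)\in\mathcal{P}[0,1]$ is a solution of Problem 1 with initial value $m_0\in\mathcal{P}[0,1]$ if $m(0)=m_0$ and, for all bounded measurable $h:[0,1]\to\mathbb{R}$ and $t\ge0$, $$\langle h,m(t)\rangle-\langle h,m(0)\rangle=\int_0^t 2\iint[h(wx+(1-w)y)-h(x)]\,1_{\{|x-y|\le\Delta\}}\,m(s)(dy)\,m(s)(dx)\,ds.$$ For each $m_0$ there is exactly one solution. A partial consensus for a threshold $\Delta'$ is a finite convex combination, with positive weights, of Dirac masses at points of $[0,1]$ at pairwise distances $>\Delta'$. *)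

theory Defs
  imports "HOL-Probability.Probability"
begin

abbreviation borel01 :: "real measure" where
  "borel01 \<equiv> restrict_space borel {0..1}"

abbreviation P01 :: "real measure set" where
  "P01 \<equiv> space (prob_algebra borel01)"

lemma in_P01_iff: "\<mu> \<in> P01 \<longleftrightarrow> prob_space \<mu> \<and> sets \<mu> = sets borel01"
  by (auto simp: space_prob_algebra)

definition interaction :: "real \<Rightarrow> real \<Rightarrow> (real \<Rightarrow> real) \<Rightarrow> real measure \<Rightarrow> real" where
  "interaction \<Delta> w h \<mu> =
     2 * (LINT x|\<mu>. LINT y|\<mu>.
            (h (w * x + (1 - w) * y) - h x) * indicator {z. \<bar>x - z\<bar> \<le> \<Delta>} y)"

text \<open>
  Only the values \<open>m t\<close> with \<open>t \<ge> 0\<close> are constrained, and test functions on \<open>[0,1]\<close> are functions on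
  the reals whose values off \<open>[0,1]\<close> play no role.
  Integrability of the integrand in \<open>s\<close> is part of the definition, because the library's integral of
  a non-measurable function is \<open>0\<close>.
\<close>

definition solution_Problem1 ::
    "real \<Rightarrow> real \<Rightarrow> real measure \<Rightarrow> (real \<Rightarrow> real measure) \<Rightarrow> bool" where
  "solution_Problem1 \<Delta> w m0 m \<longleftrightarrow>
     (\<forall>t\<ge>0. m t \<in> P01) \<and> m 0 = m0 \<and>
     (\<forall>h \<in> borel_measurable borel01. bounded (h ` {0..1}) \<longrightarrow>
        (\<forall>t\<ge>0.
           set_integrable lborel {0..t} (\<lambda>s. interaction \<Delta> w h (m s)) \<and>
           (LINT x|m t. h x) - (LINT x|m 0. h x)
             = (LINT s:{0..t}|lborel. interaction \<Delta> w h (m s))))"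

text \<open>The coarsest topology on \<open>\<P>[0,1]\<close> making \<open>\<mu> \<mapsto> \<integral>h d\<mu>\<close> continuous for all continuous \<open>h\<close>
  on \<open>[0,1]\<close>; such \<open>h\<close> are bounded by compactness.\<close>

definition weak_topology :: "real measure topology" where
  "weak_topology = topology_generated_by
     {{\<mu> \<in> P01. (LINT x|\<mu>. h x) \<in> U} | (h :: real \<Rightarrow> real) U.
        continuous_on {0..1} h \<and> open U}"

lemma topspace_weak_topology: "topspace weak_topology = P01"
proof -
  have "P01 \<in> {{\<mu> \<in> P01. (LINT x|\<mu>. h x) \<in> U} |h U.
      continuous_on {0..1} (h::real\<Rightarrow>real) \<and> open (U::real set)}"
    by (rule CollectI, rule exI[of _ "\<lambda>_. 0"], rule exI[of _ UNIV]) auto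
  thus ?thesis
    unfolding weak_topology_def topology_generated_by_topspace by blast
qed

lemma limitin_weak_topology_iff:
  "limitin weak_topology f \<mu> F \<longleftrightarrow>
     \<mu> \<in> P01 \<and> (\<forall>\<^sub>F t in F. f t \<in> P01) \<and>
     (\<forall>h :: real \<Rightarrow> real. continuous_on {0..1} h \<longrightarrow> ((\<lambda>t. LINT x|f t. h x) \<longlongrightarrow> (LINT x|\<mu>. h x)) F)"
  (is "?L \<longleftrightarrow> ?R")
proof
  assume L: ?L
  have mu: "\<mu> \<in> P01" using L by (simp add: limitin_def topspace_weak_topology)
  have "openin weak_topology P01" by (metis openin_topspace topspace_weak_topology)
  hence ev: "\<forall>\<^sub>F t in F. f t \<in> P01" using L mu by (auto simp: limitin_def)
  have "((\<lambda>t. LINT x|f t. h x) \<longlongrightarrow> (LINT x|\<mu>. h x)) F" if h: "continuous_on {0..1} h" for h :: "real \<Rightarrow> real"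
  proof (rule topological_tendstoI)
    fix U :: "real set" assume U: "open U" "(LINT x|\<mu>. h x) \<in> U"
    have "openin weak_topology {\<nu> \<in> P01. (LINT x|\<nu>. h x) \<in> U}"
      unfolding weak_topology_def by (rule topology_generated_by_Basis) (use h U in blast)
    hence "\<forall>\<^sub>F t in F. f t \<in> {\<nu> \<in> P01. (LINT x|\<nu>. h x) \<in> U}"
      using L mu U unfolding limitin_def by blast
    thus "\<forall>\<^sub>F t in F. (LINT x|f t. h x) \<in> U" by eventually_elim simp
  qed
  with mu ev show ?R by blast
next
  assume R: ?R
  have "\<mu> \<in> V \<longrightarrow> (\<forall>\<^sub>F t in F. f t \<in> V)" if "openin weak_topology V" for V
  proof -
    have "generate_topology_on {{\<mu> \<in> P01. (LINT x|\<mu>. h x) \<in> U} | (h :: real \<Rightarrow> real) U.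
        continuous_on {0..1} h \<and> open U} V"
      using that unfolding weak_topology_def openin_topology_generated_by_iff .
    thus ?thesis
    proof induction
      case (Int a b) thus ?case by (auto intro: eventually_conj)
    next
      case (UN K)
      show ?case
      proof
        assume "\<mu> \<in> \<Union>K"
        then obtain k where "k \<in> K" "\<mu> \<in> k" by blast
        with UN.IH have "\<forall>\<^sub>F t in F. f t \<in> k" by blast
        thus "\<forall>\<^sub>F t in F. f t \<in> \<Union>K" by eventually_elim (use \<open>k \<in> K\<close> in blast)
      qed
    next
      case (Basis V)
      then obtain h :: "real \<Rightarrow> real" and U where V: "V = {\<mu> \<in> P01. (LINT x|\<mu>. h x) \<in> U}"
        and h: "continuous_on {0..1} h" and U: "open U" by blast
      show ?case
      proof
        assume "\<mu> \<in> V"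
        hence "(LINT x|\<mu>. h x) \<in> U" using V by blast
        hence "\<forall>\<^sub>F t in F. (LINT x|f t. h x) \<in> U"
          using R h U by (auto intro: topological_tendstoD)
        with R show "\<forall>\<^sub>F t in F. f t \<in> V"
          unfolding V by (auto intro: eventually_conj)
      qed
    qed auto
  qed
  with R show ?L by (simp add: limitin_def topspace_weak_topology)
qed

text \<open>\<open>\<mu> = \<Sum>i=1..c. \<alpha> i \<cdot> \<delta>(x i)\<close>, with equality of measures stated setwise.\<close>

definition dirac_convex_combination ::
    "nat \<Rightarrow> (nat \<Rightarrow> real) \<Rightarrow> (nat \<Rightarrow> real) \<Rightarrow> real measure \<Rightarrow> bool" where
  "dirac_convex_combination c \<alpha> x \<mu> \<longleftrightarrow>
     (\<forall>i\<in>{1..c}. x i \<in> {0..1} \<and> \<alpha> i > 0) \<and> (\<Sum>i=1..c. \<alpha> i) = 1 \<and>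
     \<mu> \<in> P01 \<and>
     (\<forall>A\<in>sets borel01. measure \<mu> A = (\<Sum>i=1..c. \<alpha> i * measure (return borel01 (x i)) A))"

definition partial_consensus :: "real \<Rightarrow> real measure \<Rightarrow> bool" where
  "partial_consensus \<Delta>' \<mu> \<longleftrightarrow>
     (\<exists>c \<alpha> x. dirac_convex_combination c \<alpha> x \<mu> \<and>
        (\<forall>i\<in>{1..c}. \<forall>j\<in>{1..c}. i \<noteq> j \<longrightarrow> \<bar>x i - x j\<bar> > \<Delta>'))"

end

theory Submission
  imports Defs
begin

text \<open>
  Exchanging the roles of \<open>x\<close> and \<open>y\<close> replaces \<open>2 (h (w x + (1 - w) y) - h x)\<close> in the collision
  integral by \<open>h (w x + (1 - w) y) + h (w y + (1 - w) x) - h x - h y\<close>, which is nonpositive for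
  convex \<open>h\<close>. So every convex \<open>h\<close> is a Lyapunov function: \<open>\<langle>h, m(t)\<rangle>\<close> never increases. Two choices of \<open>h\<close>
  give the theorem.

  Convergence comes from the monomials, which are convex on \<open>[0,1]\<close>. Helly's theorem supplies a
  limit point \<open>m(\<infinity>)\<close> along a sequence of times; a monotone moment that converges along a sequence of
  times converges along all times, and uniform approximation by polynomials passes from moments to
  all continuous functions.

  The form of the limit comes from \<open>h x = x\<^sup>2\<close>, which is dissipated at the rate
  \<open>2 w (1 - w) \<integral>\<integral>(x - y)\<^sup>2 1{|x - y| \<le> \<Delta>}\<close>. If \<open>m(\<infinity>)\<close> charged every neighbourhood of each of two
  points at a distance strictly between \<open>0\<close> and \<open>\<Delta>\<close>, this rate would stay bounded away from \<open>0\<close>,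
  and the second moment would tend to \<open>-\<infinity>\<close>. Thus the points of the support of \<open>m(\<infinity>)\<close> are at
  pairwise distance at least \<open>\<Delta>\<close>, the support is finite, and \<open>m(\<infinity>)\<close> is a combination of Dirac masses.
\<close>

section \<open>Integration against probability measures on the unit interval\<close>

lemma space_P01: "\<mu> \<in> P01 \<Longrightarrow> space \<mu> = {0..1}"
  using sets_eq_imp_space_eq[of \<mu> borel01] by (simp add: in_P01_iff space_restrict_space)

lemma continuous_on_01_borel_bounded:
  fixes h :: "real \<Rightarrow> real"
  assumes "continuous_on {0..1} h"
  shows "h \<in> borel_measurable borel01" "bounded (h ` {0..1})"
  using assms by (auto intro!: borel_measurable_continuous_on_restrict compact_imp_bounded
      compact_continuous_image)

lemma integrable_P01:
  fixes h :: "real \<Rightarrow> real"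
  assumes \<mu>: "\<mu> \<in> P01" and h: "h \<in> borel_measurable borel01" "bounded (h ` {0..1})"
  shows "integrable \<mu> h"
proof -
  interpret prob_space \<mu> using \<mu> by (simp add: in_P01_iff)
  obtain B where B: "\<And>x. x \<in> {0..1} \<Longrightarrow> norm (h x) \<le> B"
    using h(2) by (auto simp: bounded_iff simp del: atLeastAtMost_iff)
  have "borel_measurable \<mu> = (borel_measurable borel01 :: (real \<Rightarrow> real) set)"
    using \<mu> by (intro measurable_cong_sets) (auto simp: in_P01_iff)
  hence "h \<in> borel_measurable \<mu>" using h(1) by blast
  thus ?thesis
    by (intro integrable_const_bound[of h B]) (use B \<mu> in \<open>auto simp: space_P01\<close>)
qed

lemma integrable_P01_continuous:
  fixes h :: "real \<Rightarrow> real"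
  assumes "\<mu> \<in> P01" "continuous_on {0..1} h"
  shows "integrable \<mu> h"
  using assms integrable_P01 continuous_on_01_borel_bounded by blast

lemma integrable_P01_pair:
  fixes f :: "real \<times> real \<Rightarrow> real"
  assumes \<mu>: "\<mu> \<in> P01" and f: "f \<in> borel_measurable (borel01 \<Otimes>\<^sub>M borel01)"
    and B: "\<And>x y. x \<in> {0..1} \<Longrightarrow> y \<in> {0..1} \<Longrightarrow> \<bar>f (x, y)\<bar> \<le> B"
  shows "integrable (\<mu> \<Otimes>\<^sub>M \<mu>) f"
proof -
  interpret prob_space \<mu> using \<mu> by (simp add: in_P01_iff)
  interpret P: pair_prob_space \<mu> \<mu> ..
  have s: "sets (\<mu> \<Otimes>\<^sub>M \<mu>) = sets (borel01 \<Otimes>\<^sub>M borel01)"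
    using \<mu> by (intro sets_pair_measure_cong) (auto simp: in_P01_iff)
  have "f \<in> borel_measurable (\<mu> \<Otimes>\<^sub>M \<mu>)"
    using f measurable_cong_sets[OF s refl] by blast
  thus ?thesis
    by (intro P.P.integrable_const_bound[of f B])
       (use B \<mu> in \<open>auto simp: space_P01 space_pair_measure\<close>)
qed

section \<open>Convex test functions are Lyapunov functions\<close>

lemma convex_average_in_unit_interval:
  fixes w x y :: real
  assumes "0 < w" "w < 1" "x \<in> {0..1}" "y \<in> {0..1}"
  shows "w * x + (1 - w) * y \<in> {0..1}"
  using convexD[of "{0..1::real}" x y w "1 - w"] assms by simp

lemma measurable_convex_average:
  fixes w :: real
  assumes "0 < w" "w < 1"
  shows "(\<lambda>(x, y). w * x + (1 - w) * y) \<in> borel01 \<Otimes>\<^sub>M borel01 \<rightarrow>\<^sub>M borel01"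
proof (rule measurable_restrict_space2)
  show "(\<lambda>(x, y). w * x + (1 - w) * y) \<in> space (borel01 \<Otimes>\<^sub>M borel01) \<rightarrow> {0..1}"
    using assms convex_average_in_unit_interval
    by (auto simp: space_pair_measure space_restrict_space simp del: atLeastAtMost_iff)
  have [measurable]: "(\<lambda>x. x) \<in> borel01 \<rightarrow>\<^sub>M (borel :: real measure)"
    by (rule measurable_restrict_space1) simp
  have "fst \<in> borel01 \<Otimes>\<^sub>M borel01 \<rightarrow>\<^sub>M (borel :: real measure)"
       "snd \<in> borel01 \<Otimes>\<^sub>M borel01 \<rightarrow>\<^sub>M (borel :: real measure)"
    by measurable
  thus "(\<lambda>(x, y). w * x + (1 - w) * y) \<in> borel01 \<Otimes>\<^sub>M borel01 \<rightarrow>\<^sub>M borel"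
    unfolding case_prod_beta by measurable
qed

definition collision_gain :: "real \<Rightarrow> (real \<Rightarrow> real) \<Rightarrow> real \<Rightarrow> real \<Rightarrow> real" where
  "collision_gain w h x y = h (w * x + (1 - w) * y) + h (w * y + (1 - w) * x) - h x - h y"

text \<open>The factor \<open>2\<close> of the collision integral is spent on averaging the integrand with its image
  under the exchange of \<open>x\<close> and \<open>y\<close>, which leaves the product measure invariant.\<close>

lemma interaction_symmetrized:
  assumes \<mu>: "\<mu> \<in> P01" and w: "0 < w" "w < 1"
    and h: "h \<in> borel_measurable borel01" "bounded (h ` {0..1})"
  shows "interaction \<Delta> w h \<mu> =
      (\<integral>p. collision_gain w h (fst p) (snd p) * indicator {p. \<bar>fst p - snd p\<bar> \<le> \<Delta>} p \<partial>(\<mu> \<Otimes>\<^sub>M \<mu>))"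
    and "integrable (\<mu> \<Otimes>\<^sub>M \<mu>)
      (\<lambda>p. collision_gain w h (fst p) (snd p) * indicator {p. \<bar>fst p - snd p\<bar> \<le> \<Delta>} p)"
proof -
  interpret prob_space \<mu> using \<mu> by (simp add: in_P01_iff)
  interpret P: pair_prob_space \<mu> \<mu> ..
  define F where "F p = (h (w * fst p + (1 - w) * snd p) - h (fst p)) *
      indicator {p. \<bar>fst p - snd p\<bar> \<le> \<Delta>} p" for p :: "real \<times> real"
  obtain B where B: "\<And>x. x \<in> {0..1} \<Longrightarrow> \<bar>h x\<bar> \<le> B"
    using h(2) by (auto simp: bounded_iff simp del: atLeastAtMost_iff)
  have [measurable]: "(\<lambda>x. x) \<in> borel01 \<rightarrow>\<^sub>M (borel :: real measure)"
    by (rule measurable_restrict_space1) simp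
  have [measurable]: "fst \<in> borel01 \<Otimes>\<^sub>M borel01 \<rightarrow>\<^sub>M (borel :: real measure)"
       "snd \<in> borel01 \<Otimes>\<^sub>M borel01 \<rightarrow>\<^sub>M (borel :: real measure)"
    by measurable
  have [measurable]: "(\<lambda>p. h (w * fst p + (1 - w) * snd p)) \<in> borel_measurable (borel01 \<Otimes>\<^sub>M borel01)"
    using measurable_compose[OF measurable_convex_average[OF w] h(1)]
    by (simp add: case_prod_beta)
  have [measurable]: "(\<lambda>p. h (fst p)) \<in> borel_measurable (borel01 \<Otimes>\<^sub>M borel01)"
    using measurable_compose[OF measurable_fst h(1)] .
  have [measurable]: "Measurable.pred (borel01 \<Otimes>\<^sub>M borel01) (\<lambda>p. \<bar>fst p - snd p\<bar> \<le> \<Delta>)"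
    by measurable
  have mF: "F \<in> borel_measurable (borel01 \<Otimes>\<^sub>M borel01)"
    unfolding F_def indicator_def by measurable
  have "\<bar>F (x, y)\<bar> \<le> 2 * B" if "x \<in> {0..1}" "y \<in> {0..1}" for x y
    using B[OF convex_average_in_unit_interval[OF w that]] B[OF that(1)]
    by (auto simp: F_def indicator_def)
  hence iF: "integrable (\<mu> \<Otimes>\<^sub>M \<mu>) F"
    by (intro integrable_P01_pair[OF \<mu> mF])
  have iF': "integrable (\<mu> \<Otimes>\<^sub>M \<mu>) (\<lambda>(x, y). F (y, x))"
    using P.integrable_product_swap[OF iF] .
  have sum: "F p + (case p of (x, y) \<Rightarrow> F (y, x)) =
      collision_gain w h (fst p) (snd p) * indicator {p. \<bar>fst p - snd p\<bar> \<le> \<Delta>} p" for p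
    by (cases p) (auto simp: F_def collision_gain_def indicator_def algebra_simps abs_minus_commute)
  show "integrable (\<mu> \<Otimes>\<^sub>M \<mu>)
      (\<lambda>p. collision_gain w h (fst p) (snd p) * indicator {p. \<bar>fst p - snd p\<bar> \<le> \<Delta>} p)"
    unfolding sum[symmetric] by (intro Bochner_Integration.integrable_add iF iF')
  have "interaction \<Delta> w h \<mu> = 2 * (\<integral>x. \<integral>y. F (x, y) \<partial>\<mu> \<partial>\<mu>)"
    by (simp add: interaction_def F_def indicator_def)
  also have "\<dots> = 2 * integral\<^sup>L (\<mu> \<Otimes>\<^sub>M \<mu>) F"
    by (simp add: P.integral_fst'[OF iF])
  also have "\<dots> = integral\<^sup>L (\<mu> \<Otimes>\<^sub>M \<mu>) F + (\<integral>(x, y). F (y, x) \<partial>(\<mu> \<Otimes>\<^sub>M \<mu>))"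
    using P.integral_product_swap[OF borel_measurable_integrable[OF iF]] by simp
  also have "\<dots> = (\<integral>p. F p + (case p of (x, y) \<Rightarrow> F (y, x)) \<partial>(\<mu> \<Otimes>\<^sub>M \<mu>))"
    by (rule Bochner_Integration.integral_add[symmetric, OF iF iF'])
  finally show "interaction \<Delta> w h \<mu> =
      (\<integral>p. collision_gain w h (fst p) (snd p) * indicator {p. \<bar>fst p - snd p\<bar> \<le> \<Delta>} p \<partial>(\<mu> \<Otimes>\<^sub>M \<mu>))"
    unfolding sum .
qed

lemma collision_gain_nonpos:
  assumes "convex_on {0..1} h" "0 < w" "w < 1" "x \<in> {0..1}" "y \<in> {0..1}"
  shows "collision_gain w h x y \<le> 0"
proof -
  have "h (w * x + (1 - w) * y) \<le> w * h x + (1 - w) * h y"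
       "h (w * y + (1 - w) * x) \<le> w * h y + (1 - w) * h x"
    using convex_onD[OF assms(1), of "1 - w" x y] convex_onD[OF assms(1), of "1 - w" y x] assms
    by simp_all
  thus ?thesis unfolding collision_gain_def by (simp add: algebra_simps)
qed

lemma interaction_nonpos:
  assumes \<mu>: "\<mu> \<in> P01" and w: "0 < w" "w < 1"
    and h: "continuous_on {0..1} h" "convex_on {0..1} h"
  shows "interaction \<Delta> w h \<mu> \<le> 0"
proof -
  note sym = interaction_symmetrized[OF \<mu> w continuous_on_01_borel_bounded[OF h(1)]]
  have "0 \<le> (\<integral>p. - (collision_gain w h (fst p) (snd p) *
      indicator {p. \<bar>fst p - snd p\<bar> \<le> \<Delta>} p) \<partial>(\<mu> \<Otimes>\<^sub>M \<mu>))"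
    using collision_gain_nonpos[OF h(2) w] \<mu>
    by (intro Bochner_Integration.integral_nonneg)
       (auto simp: space_pair_measure space_P01 indicator_def)
  thus ?thesis by (simp add: sym(1))
qed

lemma convex_test_antimono:
  assumes sol: "solution_Problem1 \<Delta> w m0 m" and w: "0 < w" "w < 1"
    and h: "continuous_on {0..1} h" "convex_on {0..1} h"
    and st: "0 \<le> s" "s \<le> t"
  shows "(LINT x|m t. h x) \<le> (LINT x|m s. h x)"
proof -
  note hm = continuous_on_01_borel_bounded[OF h(1)]
  let ?f = "\<lambda>r. interaction \<Delta> w h (m r)"
  have m: "m r \<in> P01" if "0 \<le> r" for r
    using sol that by (simp add: solution_Problem1_def)
  have int: "set_integrable lborel {0..r} ?f"
    and eq: "(LINT x|m r. h x) - (LINT x|m 0. h x) = (LINT r:{0..r}|lborel. ?f r)" if "0 \<le> r" for r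
    using sol hm that by (auto simp: solution_Problem1_def)
  have "(LINT r:{0..t}|lborel. ?f r) \<le> (LINT r:{0..s}|lborel. ?f r)"
    unfolding set_lebesgue_integral_def
    using int[of s] int[of t] st interaction_nonpos[OF m w h]
    by (intro integral_mono) (auto simp: set_integrable_def indicator_def)
  thus ?thesis using eq[of s] eq[of t] st by simp
qed

section \<open>Weak convergence\<close>

text \<open>Helly's selection theorem is about laws on the whole line. The limit law is carried back to
  \<open>[0,1]\<close> by the retraction \<open>x \<mapsto> max 0 (min 1 x)\<close>, which turns a continuous function on \<open>[0,1]\<close> into
  a bounded continuous function on the line.\<close>

lemma P01_sequentially_compact:
  fixes \<nu> :: "nat \<Rightarrow> real measure"
  assumes \<nu>: "\<And>n. \<nu> n \<in> P01"
  obtains r M where "strict_mono r" "M \<in> P01"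
    "\<And>h. continuous_on {0..1} h \<Longrightarrow> (\<lambda>n. LINT x|\<nu> (r n). h x) \<longlonglongrightarrow> (LINT x|M. h x :: real)"
proof -
  let ?L = "\<lambda>n. distr (\<nu> n) borel (\<lambda>x. x)"
  define c where "c x = max 0 (min 1 x)" for x :: real
  have sets_\<nu>: "sets (\<nu> n) = sets borel01" for n
    using \<nu> by (simp add: in_P01_iff)
  have id: "(\<lambda>x. x) \<in> \<nu> n \<rightarrow>\<^sub>M borel" for n
  proof -
    have "(\<lambda>x. x) \<in> borel01 \<rightarrow>\<^sub>M (borel :: real measure)"
      by (rule measurable_restrict_space1) simp
    thus ?thesis using measurable_cong_sets[OF sets_\<nu> refl] by blast
  qed
  have "tight ?L"
    unfolding tight_def
  proof (intro conjI allI impI)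
    fix n show "real_distribution (?L n)"
      using \<nu>[of n] id by (intro prob_space.real_distribution_distr) (auto simp: in_P01_iff)
  next
    fix \<epsilon> :: real assume \<epsilon>: "0 < \<epsilon>"
    have "measure (?L n) {-1<..1} = 1" for n
    proof -
      have "{-1<..1} \<inter> space (\<nu> n) = space (\<nu> n)"
        using \<nu>[of n] by (auto simp: space_P01)
      thus ?thesis
        using \<nu>[of n] prob_space.prob_space[of "\<nu> n"] by (simp add: measure_distr[OF id] in_P01_iff)
    qed
    thus "\<exists>a b. a < b \<and> (\<forall>n. 1 - \<epsilon> < measure (?L n) {a<..b})"
      using \<epsilon> by (intro exI[of _ "-1"] exI[of _ 1]) auto
  qed
  then obtain r M where r: "strict_mono (r :: nat \<Rightarrow> nat)" and M: "real_distribution M"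
    and conv: "weak_conv_m (?L \<circ> id \<circ> r) M"
    using tight_imp_convergent_subsubsequence[of ?L id] strict_mono_id by blast
  interpret M: real_distribution M by fact
  have c: "c \<in> M \<rightarrow>\<^sub>M borel01"
    by (rule measurable_restrict_space2) (auto simp: c_def[abs_def])
  show ?thesis
  proof (rule that[OF r])
    show "distr M borel01 c \<in> P01"
      using M.prob_space_distr[OF c] by (simp add: in_P01_iff)
    fix h :: "real \<Rightarrow> real" assume h: "continuous_on {0..1} h"
    obtain B where B: "\<And>x. x \<in> {0..1} \<Longrightarrow> norm (h x) \<le> B"
      using continuous_on_01_borel_bounded(2)[OF h] by (auto simp: bounded_iff simp del: atLeastAtMost_iff)
    have "continuous_on UNIV (\<lambda>x. h (c x))"
      by (rule continuous_on_compose2[OF h]) (auto simp: c_def intro!: continuous_intros)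
    hence hc: "isCont (\<lambda>x. h (c x)) x" for x
      by (simp add: continuous_on_eq_continuous_at)
    have lim: "(\<lambda>n. LINT x|?L (r n). h (c x)) \<longlonglongrightarrow> (LINT x|M. h (c x))"
    proof -
      have rd: "real_distribution ((?L \<circ> id \<circ> r) n)" for n
        using \<open>tight ?L\<close> by (simp add: tight_def)
      show ?thesis
        using weak_conv_imp_integral_bdd_continuous_conv[OF rd M conv hc, of B] B
        by (simp add: c_def)
    qed
    have "(LINT x|?L n. h (c x)) = (LINT x|\<nu> n. h x)" for n
    proof -
      have "(\<lambda>x. h (c x)) \<in> borel_measurable borel"
        using hc by (intro borel_measurable_continuous_onI) (simp add: continuous_on_eq_continuous_at)
      hence "(LINT x|?L n. h (c x)) = (LINT x|\<nu> n. h (c x))"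
        by (rule integral_distr[OF id])
      also have "\<dots> = (LINT x|\<nu> n. h x)"
        using \<nu>[of n] by (intro Bochner_Integration.integral_cong) (auto simp: space_P01 c_def)
      finally show ?thesis .
    qed
    moreover have "(LINT x|distr M borel01 c. h x) = (LINT x|M. h (c x))"
      using continuous_on_01_borel_bounded(1)[OF h] by (intro integral_distr c)
    ultimately show "(\<lambda>n. LINT x|\<nu> (r n). h x) \<longlonglongrightarrow> (LINT x|distr M borel01 c. h x)"
      using lim by simp
  qed
qed

lemma antimono_tendsto_at_top_of_sequence:
  fixes f :: "real \<Rightarrow> real"
  assumes anti: "\<And>s t. 0 \<le> s \<Longrightarrow> s \<le> t \<Longrightarrow> f t \<le> f s"
    and T: "filterlim T at_top sequentially" "\<And>n. 0 \<le> T n"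
    and lim: "(\<lambda>n. f (T n)) \<longlonglongrightarrow> L"
  shows "(f \<longlongrightarrow> L) at_top"
proof (rule decreasing_tendsto)
  have "L \<le> f t" if "0 \<le> t" for t
  proof (rule tendsto_upperbound[OF lim])
    have "eventually (\<lambda>n. t \<le> T n) sequentially"
      using T(1) by (simp add: filterlim_at_top)
    thus "eventually (\<lambda>n. f (T n) \<le> f t) sequentially"
      by eventually_elim (use anti that in auto)
  qed simp
  thus "eventually (\<lambda>t. L \<le> f t) at_top"
    using eventually_ge_at_top[of 0] by (rule eventually_mono[rotated])
next
  fix x assume "L < x"
  hence "eventually (\<lambda>n. f (T n) < x) sequentially"
    using order_tendstoD(2)[OF lim] by blast
  then obtain n where n: "f (T n) < x"
    by (auto simp: eventually_sequentially)
  show "eventually (\<lambda>t. f t < x) at_top"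
    using eventually_ge_at_top[of "T n"]
  proof eventually_elim
    case (elim t)
    thus ?case using anti[OF T(2)[of n] elim] n by simp
  qed
qed

lemma abs_integral_diff_le_P01:
  fixes f g :: "real \<Rightarrow> real"
  assumes \<mu>: "\<mu> \<in> P01" and f: "continuous_on {0..1} f" and g: "continuous_on {0..1} g"
    and fg: "\<And>x. x \<in> {0..1} \<Longrightarrow> \<bar>f x - g x\<bar> \<le> e"
  shows "\<bar>(LINT x|\<mu>. f x) - (LINT x|\<mu>. g x)\<bar> \<le> e"
proof -
  interpret prob_space \<mu> using \<mu> by (simp add: in_P01_iff)
  have i: "integrable \<mu> f" "integrable \<mu> g"
    using \<mu> f g integrable_P01_continuous by blast+
  have "\<bar>LINT x|\<mu>. f x - g x\<bar> \<le> (LINT x|\<mu>. \<bar>f x - g x\<bar>)"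
    by (rule integral_abs_bound)
  also have "\<dots> \<le> (LINT x|\<mu>. e)"
    using i fg \<mu> by (intro integral_mono) (auto simp: space_P01)
  finally show ?thesis using i by (simp add: prob_space)
qed

text \<open>Polynomials are uniformly dense in the continuous functions on \<open>[0,1]\<close>, and integration against
  probability measures is uniformly Lipschitz for the supremum norm.\<close>

lemma tendsto_of_moments_P01:
  fixes h :: "real \<Rightarrow> real"
  assumes m: "\<forall>\<^sub>F t in F. m t \<in> P01" and M: "M \<in> P01" and h: "continuous_on {0..1} h"
    and mom: "\<And>k. ((\<lambda>t. LINT x|m t. x ^ k) \<longlongrightarrow> (LINT x|M. x ^ k)) F"
  shows "((\<lambda>t. LINT x|m t. h x) \<longlongrightarrow> (LINT x|M. h x)) F"
proof (rule tendstoI)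
  fix e :: real assume e: "0 < e"
  obtain p where "real_polynomial_function p" and p: "\<And>x. x \<in> {0..1} \<Longrightarrow> \<bar>h x - p x\<bar> < e / 3"
    using Stone_Weierstrass_real_polynomial_function[of "{0..1::real}" h "e / 3"] h e by auto
  then obtain a n where p_eq: "p = (\<lambda>x. \<Sum>i\<le>n. a i * x ^ i)"
    unfolding real_polynomial_function_iff_sum by blast
  have pc: "continuous_on {0..1} p" unfolding p_eq by (intro continuous_intros)
  have int_p: "(LINT x|\<mu>. p x) = (\<Sum>i\<le>n. a i * (LINT x|\<mu>. x ^ i))" if "\<mu> \<in> P01" for \<mu>
  proof -
    have "integrable \<mu> (\<lambda>x. x ^ i)" for i :: nat
      by (intro integrable_P01_continuous that continuous_intros)
    thus ?thesis unfolding p_eq by (subst Bochner_Integration.integral_sum) auto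
  qed
  have "((\<lambda>t. \<Sum>i\<le>n. a i * (LINT x|m t. x ^ i)) \<longlongrightarrow> (\<Sum>i\<le>n. a i * (LINT x|M. x ^ i))) F"
    by (intro tendsto_intros mom)
  hence "\<forall>\<^sub>F t in F. dist (\<Sum>i\<le>n. a i * (LINT x|m t. x ^ i)) (\<Sum>i\<le>n. a i * (LINT x|M. x ^ i)) < e / 3"
    using e by (intro tendstoD) auto
  thus "\<forall>\<^sub>F t in F. dist (LINT x|m t. h x) (LINT x|M. h x) < e"
    using m
  proof eventually_elim
    case (elim t)
    have "\<bar>(LINT x|\<mu>. h x) - (LINT x|\<mu>. p x)\<bar> \<le> e / 3" if "\<mu> \<in> P01" for \<mu>
      using that h pc p by (intro abs_integral_diff_le_P01) (auto intro: less_imp_le)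
    from this[OF M] this[OF elim(2)] elim(1) show ?case
      unfolding int_p[OF M, symmetric] int_p[OF elim(2), symmetric] dist_real_def by linarith
  qed
qed

lemma solution_converges_weakly:
  assumes sol: "solution_Problem1 \<Delta> w m0 m" and w: "0 < w" "w < 1"
  obtains M where "limitin weak_topology m M at_top"
proof -
  have m: "m t \<in> P01" if "0 \<le> t" for t
    using sol that by (simp add: solution_Problem1_def)
  have evm: "\<forall>\<^sub>F t in at_top. m t \<in> P01"
    using eventually_ge_at_top[of 0] by eventually_elim (rule m)
  obtain r M where r: "strict_mono r" and M: "M \<in> P01"
    and conv: "\<And>h. continuous_on {0..1} h \<Longrightarrow>
      (\<lambda>n. LINT x|m (real (r n)). h x) \<longlonglongrightarrow> (LINT x|M. h x :: real)"
    using P01_sequentially_compact[of "\<lambda>n. m (real n)"] m by (metis of_nat_0_le_iff)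
  have mom: "((\<lambda>t. LINT x|m t. x ^ k) \<longlongrightarrow> (LINT x|M. x ^ k)) at_top" for k
  proof (rule antimono_tendsto_at_top_of_sequence)
    have "convex_on {0::real..} (\<lambda>x. x ^ k)"
      using convex_power_odd[of k] convex_power_even[of k] convex_on_subset
      by (cases "even k") blast+
    hence "convex_on {0..1::real} (\<lambda>x. x ^ k)"
      by (rule convex_on_subset) auto
    thus "(LINT x|m t. x ^ k) \<le> (LINT x|m s. x ^ k)" if "0 \<le> s" "s \<le> t" for s t
      using that by (intro convex_test_antimono[OF sol w] continuous_intros)
    show "filterlim (\<lambda>n. real (r n)) at_top sequentially"
      using filterlim_compose[OF filterlim_real_sequentially filterlim_subseq[OF r]] .
    show "(\<lambda>n. LINT x|m (real (r n)). x ^ k) \<longlonglongrightarrow> (LINT x|M. x ^ k)"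
      by (intro conv continuous_intros)
  qed simp
  have "limitin weak_topology m M at_top"
    unfolding limitin_weak_topology_iff using M evm tendsto_of_moments_P01[OF evm M _ mom] by blast
  thus ?thesis by (rule that)
qed

section \<open>Dissipation of the second moment\<close>

text \<open>For \<open>h x = x\<^sup>2\<close> the symmetrized integrand is exactly \<open>-2 w (1 - w) (x - y)\<^sup>2\<close>; testing it
  against a product \<open>\<phi> x * \<psi> y\<close> bounds the dissipation below by a quantity that is visibly
  continuous for weak convergence, although \<open>1{|x - y| \<le> \<Delta>}\<close> is not.\<close>

lemma second_moment_dissipation:
  fixes \<phi> \<psi> :: "real \<Rightarrow> real"
  assumes \<mu>: "\<mu> \<in> P01" and w: "0 < w" "w < 1" and \<delta>: "0 \<le> \<delta>"
    and \<phi>: "continuous_on {0..1} \<phi>" "\<And>x. \<phi> x \<in> {0..1}"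
    and \<psi>: "continuous_on {0..1} \<psi>" "\<And>x. \<psi> x \<in> {0..1}"
    and sep: "\<And>x y. \<phi> x \<noteq> 0 \<Longrightarrow> \<psi> y \<noteq> 0 \<Longrightarrow> \<delta> \<le> \<bar>x - y\<bar> \<and> \<bar>x - y\<bar> \<le> \<Delta>"
  shows "interaction \<Delta> w (\<lambda>x. x\<^sup>2) \<mu> \<le>
    - (2 * w * (1 - w) * \<delta>\<^sup>2 * ((LINT x|\<mu>. \<phi> x) * (LINT x|\<mu>. \<psi> x)))"
proof -
  interpret prob_space \<mu> using \<mu> by (simp add: in_P01_iff)
  interpret P: pair_prob_space \<mu> \<mu> ..
  have "continuous_on {0..1::real} (\<lambda>x. x\<^sup>2)" by (intro continuous_intros)
  note sym = interaction_symmetrized[OF \<mu> w continuous_on_01_borel_bounded[OF this], of \<Delta>]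
  have gain: "collision_gain w (\<lambda>x. x\<^sup>2) x y = - (2 * w * (1 - w) * (x - y)\<^sup>2)" for x y
    unfolding collision_gain_def by (simp add: power2_eq_square algebra_simps)
  have i: "integrable \<mu> \<phi>" "integrable \<mu> \<psi>"
    using \<mu> \<phi> \<psi> integrable_P01_continuous by blast+
  have meas: "(\<lambda>p. \<phi> (fst p) * \<psi> (snd p)) \<in> borel_measurable (borel01 \<Otimes>\<^sub>M borel01)"
    using measurable_compose[OF measurable_fst continuous_on_01_borel_bounded(1)[OF \<phi>(1)]]
      measurable_compose[OF measurable_snd continuous_on_01_borel_bounded(1)[OF \<psi>(1)]]
    by (intro borel_measurable_times)
  have ip: "integrable (\<mu> \<Otimes>\<^sub>M \<mu>) (\<lambda>p. \<phi> (fst p) * \<psi> (snd p))"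
    by (rule integrable_P01_pair[OF \<mu> meas, of 1])
       (use \<phi>(2) \<psi>(2) in \<open>auto simp: abs_mult intro!: mult_le_one\<close>)
  have prod: "(\<integral>p. \<phi> (fst p) * \<psi> (snd p) \<partial>(\<mu> \<Otimes>\<^sub>M \<mu>)) = (LINT x|\<mu>. \<phi> x) * (LINT x|\<mu>. \<psi> x)"
    by (subst P.integral_fst'[OF ip, symmetric]) simp
  have "interaction \<Delta> w (\<lambda>x. x\<^sup>2) \<mu> \<le>
      (\<integral>p. - (2 * w * (1 - w) * \<delta>\<^sup>2) * (\<phi> (fst p) * \<psi> (snd p)) \<partial>(\<mu> \<Otimes>\<^sub>M \<mu>))"
    unfolding sym(1)
  proof (rule integral_mono[OF sym(2)])
    show "integrable (\<mu> \<Otimes>\<^sub>M \<mu>) (\<lambda>p. - (2 * w * (1 - w) * \<delta>\<^sup>2) * (\<phi> (fst p) * \<psi> (snd p)))"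
      using ip by (rule integrable_mult_right)
    fix p :: "real \<times> real"
    obtain x y where p: "p = (x, y)" by (cases p)
    show "collision_gain w (\<lambda>x. x\<^sup>2) (fst p) (snd p) * indicator {p. \<bar>fst p - snd p\<bar> \<le> \<Delta>} p
        \<le> - (2 * w * (1 - w) * \<delta>\<^sup>2) * (\<phi> (fst p) * \<psi> (snd p))"
    proof (cases "\<phi> x \<noteq> 0 \<and> \<psi> y \<noteq> 0")
      case True
      hence d: "\<delta> \<le> \<bar>x - y\<bar>" "\<bar>x - y\<bar> \<le> \<Delta>" using sep by auto
      have "\<delta>\<^sup>2 \<le> (x - y)\<^sup>2" using power_mono[OF d(1) \<delta>, of 2] by simp
      moreover have "\<phi> x * \<psi> y \<le> 1" "0 \<le> \<phi> x * \<psi> y"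
        using \<phi>(2)[of x] \<psi>(2)[of y] by (auto intro: mult_le_one)
      ultimately have "\<delta>\<^sup>2 * (\<phi> x * \<psi> y) \<le> (x - y)\<^sup>2 * 1"
        by (intro mult_mono) auto
      hence "2 * w * (1 - w) * (\<delta>\<^sup>2 * (\<phi> x * \<psi> y)) \<le> 2 * w * (1 - w) * (x - y)\<^sup>2"
        using w by (intro mult_left_mono) auto
      thus ?thesis using d(2) by (simp add: p gain mult.assoc)
    next
      case False
      thus ?thesis using w by (auto simp: p gain indicator_def)
    qed
  qed
  also have "\<dots> = - (2 * w * (1 - w) * \<delta>\<^sup>2 * ((LINT x|\<mu>. \<phi> x) * (LINT x|\<mu>. \<psi> x)))"
    by (simp only: integral_mult_right_zero prod minus_mult_left)
  finally show ?thesis .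
qed

text \<open>The second moment stays nonnegative, so the dissipation cannot remain bounded away from \<open>0\<close>.\<close>

lemma weak_limit_no_close_masses:
  fixes \<phi> \<psi> :: "real \<Rightarrow> real"
  assumes sol: "solution_Problem1 \<Delta> w m0 m" and w: "0 < w" "w < 1" and \<delta>: "0 < \<delta>"
    and lim: "limitin weak_topology m M at_top"
    and \<phi>: "continuous_on {0..1} \<phi>" "\<And>x. \<phi> x \<in> {0..1}"
    and \<psi>: "continuous_on {0..1} \<psi>" "\<And>x. \<psi> x \<in> {0..1}"
    and sep: "\<And>x y. \<phi> x \<noteq> 0 \<Longrightarrow> \<psi> y \<noteq> 0 \<Longrightarrow> \<delta> \<le> \<bar>x - y\<bar> \<and> \<bar>x - y\<bar> \<le> \<Delta>"
    and pos: "0 < (LINT x|M. \<phi> x)" "0 < (LINT x|M. \<psi> x)"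
  shows False
proof -
  let ?f = "\<lambda>r. interaction \<Delta> w (\<lambda>x. x\<^sup>2) (m r)"
  let ?q = "\<lambda>t. (LINT x|m t. \<phi> x) * (LINT x|m t. \<psi> x)"
  define q where "q = (LINT x|M. \<phi> x) * (LINT x|M. \<psi> x)"
  define c where "c = 2 * w * (1 - w) * \<delta>\<^sup>2 * (q / 2)"
  have q: "0 < q" using pos by (simp add: q_def)
  hence c: "0 < c" using w \<delta> by (simp add: c_def)
  have cont: "continuous_on {0..1::real} (\<lambda>x. x\<^sup>2)" by (intro continuous_intros)
  have conv: "convex_on {0..1::real} (\<lambda>x. x\<^sup>2)"
    using convex_power2 by (rule convex_on_subset) auto
  have m: "m t \<in> P01" if "0 \<le> t" for t
    using sol that by (simp add: solution_Problem1_def)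
  have "(?q \<longlongrightarrow> q) at_top"
    unfolding q_def using lim \<phi>(1) \<psi>(1)
    by (intro tendsto_mult) (auto simp: limitin_weak_topology_iff)
  hence "\<forall>\<^sub>F t in at_top. q / 2 < ?q t"
    by (rule order_tendstoD) (use q in simp)
  then obtain T0 where T0: "\<And>t. T0 \<le> t \<Longrightarrow> q / 2 < ?q t"
    by (auto simp: eventually_at_top_linorder)
  define T where "T = max 0 T0"
  \<comment> \<open>By this time the second moment has lost \<open>2\<close>, more than its initial value.\<close>
  define t where "t = T + 2 / c"
  have Tt: "0 \<le> T" "T \<le> t" "0 \<le> t" using c by (auto simp: T_def t_def)
  have le0: "?f r \<le> 0" if "0 \<le> r" for r
    by (rule interaction_nonpos[OF m[OF that] w cont conv])
  have lec: "?f r \<le> - c" if "T \<le> r" for r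
  proof -
    have "0 \<le> r" "T0 \<le> r" using that by (auto simp: T_def)
    have "c \<le> 2 * w * (1 - w) * \<delta>\<^sup>2 * ?q r"
      unfolding c_def using T0[OF \<open>T0 \<le> r\<close>] w by (intro mult_left_mono) auto
    thus ?thesis
      using second_moment_dissipation[OF m[OF \<open>0 \<le> r\<close>] w less_imp_le[OF \<delta>] \<phi> \<psi> sep] by linarith
  qed
  have int: "set_integrable lborel {0..t} ?f"
    and eq: "(LINT x|m t. x\<^sup>2) - (LINT x|m 0. x\<^sup>2) = (LINT r:{0..t}|lborel. ?f r)"
    using sol continuous_on_01_borel_bounded[OF cont] Tt(3) by (auto simp: solution_Problem1_def)
  have "(LINT r:{0..t}|lborel. ?f r) \<le> (LINT r:{T..t}|lborel. - c)"
    unfolding set_lebesgue_integral_def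
  proof (rule integral_mono)
    show "integrable lborel (\<lambda>r. indicator {0..t} r *\<^sub>R ?f r)"
      using int by (simp add: set_integrable_def)
    show "integrable lborel (\<lambda>r. indicator {T..t} r *\<^sub>R - c)"
      using Tt by (intro integrable_scaleR_left integrable_real_indicator) auto
    show "indicator {0..t} r *\<^sub>R ?f r \<le> indicator {T..t} r *\<^sub>R - c" for r
      using lec[of r] le0[of r] Tt by (auto simp: indicator_def)
  qed
  also have "\<dots> = - c * (t - T)"
    using Tt by (simp add: set_lebesgue_integral_def)
  also have "\<dots> = - 2" using c by (simp add: t_def)
  finally have "(LINT x|m t. x\<^sup>2) \<le> (LINT x|m 0. x\<^sup>2) - 2" using eq by simp
  moreover have "0 \<le> (LINT x|m t. x\<^sup>2)" by simp
  moreover have "(LINT x|m 0. x\<^sup>2) \<le> 1"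
  proof -
    have "m 0 \<in> P01" by (rule m) simp
    interpret m0: prob_space "m 0" using \<open>m 0 \<in> P01\<close> by (simp add: in_P01_iff)
    have "(LINT x|m 0. x\<^sup>2) \<le> (LINT x|m 0. 1)"
      using \<open>m 0 \<in> P01\<close> integrable_P01_continuous[OF \<open>m 0 \<in> P01\<close> cont]
      by (intro integral_mono) (auto simp: space_P01 power_le_one)
    thus ?thesis by (simp add: m0.prob_space)
  qed
  ultimately show False by linarith
qed

section \<open>Measures with separated support\<close>

text \<open>The complement of the support is the union of all open null sets, which may be uncountably many;
  by Lindelof's theorem countably many of them already cover it.\<close>

lemma P01_topological_support:
  assumes \<mu>: "\<mu> \<in> P01"
  obtains S where "S \<subseteq> {0..1}" "{0..1} - S \<in> null_sets \<mu>"
    "\<And>x U. x \<in> S \<Longrightarrow> open U \<Longrightarrow> x \<in> U \<Longrightarrow> 0 < measure \<mu> (U \<inter> {0..1})"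
proof -
  interpret prob_space \<mu> using \<mu> by (simp add: in_P01_iff)
  have ms: "U \<inter> {0..1} \<in> sets \<mu>" if "open U" for U :: "real set"
    using \<mu> that by (auto simp: in_P01_iff sets_restrict_space Int_commute)
  define \<U> where "\<U> = {U :: real set. open U \<and> U \<inter> {0..1} \<in> null_sets \<mu>}"
  obtain \<V> where \<V>: "\<V> \<subseteq> \<U>" "countable \<V>" "\<Union>\<V> = \<Union>\<U>"
    using Lindelof[of \<U>] unfolding \<U>_def by blast
  show ?thesis
  proof (rule that[of "{0..1} - \<Union>\<U>"])
    have "(\<Union>U\<in>\<V>. U \<inter> {0..1}) \<in> null_sets \<mu>"
      using \<V> by (intro null_sets_UN') (auto simp: \<U>_def)
    moreover have "(\<Union>U\<in>\<V>. U \<inter> {0..1}) = {0..1} - ({0..1} - \<Union>\<U>)"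
      using \<V>(3) by auto
    ultimately show "{0..1} - ({0..1} - \<Union>\<U>) \<in> null_sets \<mu>" by simp
    fix x U assume "x \<in> {0..1} - \<Union>\<U>" "open U" "x \<in> U"
    hence "U \<inter> {0..1} \<notin> null_sets \<mu>" by (auto simp: \<U>_def)
    thus "0 < measure \<mu> (U \<inter> {0..1})"
      using ms[OF \<open>open U\<close>] by (auto simp: null_sets_def emeasure_eq_measure zero_less_measure_iff)
  qed blast
qed

definition tent :: "real \<Rightarrow> real \<Rightarrow> real \<Rightarrow> real" where
  "tent x e z = max 0 (1 - \<bar>z - x\<bar> / e)"

lemma tent_props:
  assumes "0 < e"
  shows "continuous_on A (tent x e)" "tent x e z \<in> {0..1}" "tent x e z \<noteq> 0 \<longleftrightarrow> z \<in> ball x e"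
proof -
  show "continuous_on A (tent x e)"
    unfolding tent_def[abs_def] using assms by (intro continuous_intros) auto
qed (use assms in \<open>auto simp: tent_def dist_real_def field_simps max_def\<close>)

lemma tent_integral_pos:
  assumes \<mu>: "\<mu> \<in> P01" and e: "0 < e" and pos: "0 < measure \<mu> (ball x e \<inter> {0..1})"
  shows "0 < (LINT z|\<mu>. tent x e z)"
proof (rule ccontr)
  assume "\<not> ?thesis"
  moreover have "0 \<le> (LINT z|\<mu>. tent x e z)"
    using tent_props(2)[OF e] by (intro Bochner_Integration.integral_nonneg) auto
  ultimately have "(LINT z|\<mu>. tent x e z) = 0" by simp
  hence "AE z in \<mu>. tent x e z = 0"
    using integrable_P01_continuous[OF \<mu> tent_props(1)[OF e]] tent_props(2)[OF e]
    by (subst (asm) integral_nonneg_eq_0_iff_AE) auto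
  hence "AE z in \<mu>. z \<notin> ball x e \<inter> {0..1}"
    using tent_props(3)[OF e] by (auto elim: eventually_mono)
  hence "emeasure \<mu> (ball x e \<inter> {0..1}) = 0"
    using \<mu> by (subst AE_iff_measurable[symmetric, of _ _ "\<lambda>z. z \<notin> ball x e \<inter> {0..1}"])
      (auto simp: in_P01_iff sets_restrict_space Int_commute space_P01)
  thus False using pos by (simp add: measure_def)
qed

lemma finite_of_separated_unit_interval:
  fixes S :: "real set"
  assumes S: "S \<subseteq> {0..1}" and d: "0 < d"
    and sep: "\<And>x y. x \<in> S \<Longrightarrow> y \<in> S \<Longrightarrow> x \<noteq> y \<Longrightarrow> d \<le> \<bar>x - y\<bar>"
  shows "finite S"
proof (rule inj_on_finite)
  show "inj_on (\<lambda>x. \<lfloor>x / d\<rfloor>) S"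
  proof (rule inj_onI, rule ccontr)
    fix x y assume xy: "x \<in> S" "y \<in> S" "\<lfloor>x / d\<rfloor> = \<lfloor>y / d\<rfloor>" "x \<noteq> y"
    have "\<bar>x / d - y / d\<bar> < 1" using xy(3) by linarith
    hence "\<bar>x - y\<bar> < d" using d by (simp add: diff_divide_distrib[symmetric])
    with sep[OF xy(1,2,4)] show False by simp
  qed
  show "(\<lambda>x. \<lfloor>x / d\<rfloor>) ` S \<subseteq> {0..\<lfloor>1 / d\<rfloor>}"
  proof (rule image_subsetI)
    fix x assume "x \<in> S"
    hence "0 \<le> x / d" "x / d \<le> 1 / d" using S d by (auto intro!: divide_right_mono)
    thus "\<lfloor>x / d\<rfloor> \<in> {0..\<lfloor>1 / d\<rfloor>}" by (auto intro: floor_mono)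
  qed
qed simp

text \<open>A separated support in \<open>[0,1]\<close> is finite, so the measure is the sum of its atoms; each atom is
  positive because a ball of radius \<open>d\<close> around a point of the support contains no other such point.\<close>

lemma separated_support_imp_dirac_combination:
  assumes \<mu>: "\<mu> \<in> P01" and d: "0 < d"
    and S: "S \<subseteq> {0..1}" "{0..1} - S \<in> null_sets \<mu>"
      "\<And>x U. x \<in> S \<Longrightarrow> open U \<Longrightarrow> x \<in> U \<Longrightarrow> 0 < measure \<mu> (U \<inter> {0..1})"
    and sep: "\<And>x y. x \<in> S \<Longrightarrow> y \<in> S \<Longrightarrow> x \<noteq> y \<Longrightarrow> d \<le> \<bar>x - y\<bar>"
  shows "\<exists>c \<alpha> x. dirac_convex_combination c \<alpha> x \<mu> \<and>
      (\<forall>i\<in>{1..c}. \<forall>j\<in>{1..c}. i \<noteq> j \<longrightarrow> d \<le> \<bar>x i - x j\<bar>)"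
proof -
  interpret prob_space \<mu> using \<mu> by (simp add: in_P01_iff)
  have sets: "sets \<mu> = sets borel01" and sp: "space \<mu> = {0..1}"
    using \<mu> by (auto simp: in_P01_iff space_P01)
  have fin: "finite S" by (rule finite_of_separated_unit_interval[OF S(1) d sep])
  have sing: "{x} \<in> sets \<mu>" if "x \<in> {0..1}" for x
    using that by (auto simp: sets sets_restrict_space intro!: image_eqI[of _ _ "{x}"])
  have SA: "S \<inter> A \<in> sets \<mu>" for A
  proof -
    have "(\<Union>x\<in>S \<inter> A. {x}) \<in> sets \<mu>"
      using fin S(1) sing by (intro sets.finite_UN) auto
    thus ?thesis by simp
  qed
  have meas: "measure \<mu> A = (\<Sum>x\<in>S. measure \<mu> {x} * indicator A x)" if A: "A \<in> sets \<mu>" for A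
  proof -
    have "measure \<mu> A = measure \<mu> (S \<inter> A)"
    proof (rule measure_eq_AE)
      show "AE x in \<mu>. (x \<in> A) = (x \<in> S \<inter> A)"
        using AE_not_in[OF S(2)] AE_space by eventually_elim (auto simp: sp)
    qed (use A SA in auto)
    also have "\<dots> = (\<Sum>x\<in>S \<inter> A. measure \<mu> {x})"
      using fin S(1) sing by (intro finite_measure_eq_sum_singleton) auto
    also have "\<dots> = (\<Sum>x\<in>S. measure \<mu> {x} * indicator A x)"
      using fin by (intro sum.mono_neutral_cong_left) (auto simp: indicator_def)
    finally show ?thesis .
  qed
  have atom: "0 < measure \<mu> {x}" if x: "x \<in> S" for x
  proof -
    have U: "ball x d \<inter> {0..1} \<in> sets \<mu>"
      by (auto simp: sets sets_restrict_space Int_commute)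
    have "0 < measure \<mu> (ball x d \<inter> {0..1})"
      using S(3)[OF x, of "ball x d"] d by simp
    also have "\<dots> = (\<Sum>y\<in>S. measure \<mu> {y} * indicator (ball x d \<inter> {0..1}) y)"
      by (rule meas[OF U])
    also have "\<dots> = (\<Sum>y\<in>S. if y = x then measure \<mu> {x} else 0)"
    proof (rule sum.cong[OF refl])
      fix y assume y: "y \<in> S"
      show "measure \<mu> {y} * indicator (ball x d \<inter> {0..1}) y = (if y = x then measure \<mu> {x} else 0)"
        using sep[OF x y] d x S(1) by (auto simp: indicator_def dist_real_def)
    qed
    also have "\<dots> = measure \<mu> {x}" using fin x by simp
    finally show ?thesis .
  qed
  obtain x where x: "bij_betw x {1..card S} S"
    using ex_bij_betw_nat_finite_1[OF fin] by blast
  have xS: "x i \<in> S" if "i \<in> {1..card S}" for i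
    using x that by (auto simp: bij_betw_def)
  have re: "(\<Sum>i=1..card S. g (x i)) = (\<Sum>y\<in>S. g y)" for g :: "real \<Rightarrow> real"
    by (rule sum.reindex_bij_betw[OF x])
  have "dirac_convex_combination (card S) (\<lambda>i. measure \<mu> {x i}) x \<mu>"
    unfolding dirac_convex_combination_def
  proof (intro conjI ballI \<mu>)
    show "x i \<in> {0..1}" "0 < measure \<mu> {x i}" if "i \<in> {1..card S}" for i
      using xS[OF that] S(1) atom by auto
    have "(\<Sum>y\<in>S. measure \<mu> {y}) = (\<Sum>y\<in>S. measure \<mu> {y} * indicator (space \<mu>) y)"
      using S(1) by (intro sum.cong) (auto simp: sp)
    also have "\<dots> = 1" using meas[OF sets.top] prob_space by simp
    finally show "(\<Sum>i=1..card S. measure \<mu> {x i}) = 1"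
      using re[of "\<lambda>y. measure \<mu> {y}"] by simp
    fix A assume A: "A \<in> sets borel01"
    have "measure \<mu> A = (\<Sum>i=1..card S. measure \<mu> {x i} * indicator A (x i))"
      unfolding re[of "\<lambda>y. measure \<mu> {y} * indicator A y"] using meas A by (simp add: sets)
    thus "measure \<mu> A = (\<Sum>i=1..card S. measure \<mu> {x i} * measure (return borel01 (x i)) A)"
      using A by (simp add: measure_return)
  qed
  moreover have "d \<le> \<bar>x i - x j\<bar>" if "i \<in> {1..card S}" "j \<in> {1..card S}" "i \<noteq> j" for i j
    using that x xS sep by (metis bij_betw_def inj_on_eq_iff)
  ultimately show ?thesis by blast
qed

section \<open>Convergence to partial consensus\<close>

theorem theorem5p1:
  fixes \<Delta> w :: real and m0 :: "real measure" and m :: "real \<Rightarrow> real measure"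
  assumes "0 < \<Delta>" "\<Delta> \<le> 1" and "0 < w" "w < 1"
    and "m0 \<in> P01"
    and "solution_Problem1 \<Delta> w m0 m"
  shows "\<exists>m_inf. limitin weak_topology m m_inf at_top \<and>
           (\<forall>\<Delta>'<\<Delta>. partial_consensus \<Delta>' m_inf) \<and>
           (\<exists>c \<alpha> x. dirac_convex_combination c \<alpha> x m_inf \<and>
              (\<forall>i\<in>{1..c}. \<forall>j\<in>{1..c}. i \<noteq> j \<longrightarrow> \<bar>x i - x j\<bar> \<ge> \<Delta>))"
proof -
  obtain M where lim: "limitin weak_topology m M at_top"
    using solution_converges_weakly[OF assms(6,3,4)] .
  have M: "M \<in> P01" using lim by (simp add: limitin_weak_topology_iff)
  obtain S where S: "S \<subseteq> {0..1}" "{0..1} - S \<in> null_sets M"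
    "\<And>x U. x \<in> S \<Longrightarrow> open U \<Longrightarrow> x \<in> U \<Longrightarrow> 0 < measure M (U \<inter> {0..1})"
    using P01_topological_support[OF M] by blast
  have sep: "\<Delta> \<le> \<bar>x - y\<bar>" if xy: "x \<in> S" "y \<in> S" "x \<noteq> y" for x y
  proof (rule ccontr)
    assume "\<not> \<Delta> \<le> \<bar>x - y\<bar>"
    \<comment> \<open>Balls of radius \<open>e\<close> around \<open>x\<close> and \<open>y\<close> consist of points at mutual distance between
      \<open>d / 2\<close> and \<open>\<Delta>\<close>.\<close>
    define d where "d = \<bar>x - y\<bar>"
    define e where "e = min (d / 4) ((\<Delta> - d) / 2)"
    have d: "0 < d" "d < \<Delta>" using \<open>\<not> \<Delta> \<le> \<bar>x - y\<bar>\<close> xy by (auto simp: d_def)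
    hence e: "0 < e" by (simp add: e_def)
    have pos: "0 < (LINT v|M. tent z e v)" if "z \<in> S" for z
      using S(3)[OF that, of "ball z e"] e by (intro tent_integral_pos[OF M e]) auto
    have near: "d / 2 \<le> \<bar>u - v\<bar> \<and> \<bar>u - v\<bar> \<le> \<Delta>" if "tent x e u \<noteq> 0" "tent y e v \<noteq> 0" for u v
    proof -
      have "\<bar>x - u\<bar> < e" "\<bar>y - v\<bar> < e"
        using that tent_props(3)[OF e] by (auto simp: dist_real_def)
      moreover have "e \<le> d / 4" "e \<le> (\<Delta> - d) / 2"
        unfolding e_def by (rule min.cobounded1, rule min.cobounded2)
      ultimately show ?thesis using d unfolding d_def by (auto simp: abs_if split: if_splits)
    qed
    show False
      using weak_limit_no_close_masses[OF assms(6,3,4) _ lim tent_props(1,2)[OF e]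
          tent_props(1,2)[OF e] near pos[OF xy(1)] pos[OF xy(2)]] d by simp
  qed
  have dirac: "\<exists>c \<alpha> x. dirac_convex_combination c \<alpha> x M \<and>
      (\<forall>i\<in>{1..c}. \<forall>j\<in>{1..c}. i \<noteq> j \<longrightarrow> \<Delta> \<le> \<bar>x i - x j\<bar>)"
    by (rule separated_support_imp_dirac_combination[OF M assms(1) S(1,2)]) (fact S(3), fact sep)
  hence "partial_consensus \<Delta>' M" if "\<Delta>' < \<Delta>" for \<Delta>'
    using that unfolding partial_consensus_def by (meson less_le_trans)
  thus ?thesis using lim dirac by blast
qed

end
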